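(* Let $(S;\cdot,\backslash,/)$ be a right product quasigroup. Then $S$ is a right product left loop if and only if it satisfies any one (and hence all) of the following identities: (LL1) $(x/x)\cdot y=y$; (LL2) $(x/x)\cdot z=(y/y)\cdot z$; (LL3) $(x\circ y)/(x\circ y)=y/y$, where $\circ$ is any one of the operations $\cdot,\backslash,/$. That is, each of these identities (with (LL3) counted as one identity for each choice of $\circ$) is individually equivalent to $S$ being a right product left loop.
   Context: A quasigroup is an algebra $(Q;\cdot,\backslash,/)$ satisfying $x\backslash(x\cdot y)=y$, $x\cdot(x\backslash y)=y$, $(x\cdot y)/y=x$, $(x/y)\cdot y=x$. A left loop is a quasigroup satisfying $x/x=y/y$. A right zero semigroup is regarded as an algebra $(R;\cdot,\backslash,/)$ with $x\cdot y=x\backslash y=x/y=y$. A right product quasigroup (respectively right product left loop) is an algebra isomorphic to a direct product $Q\times R$ with $Q$ a quasigroup (respectively a left loop) and $R$ a right zero semigroup. *)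

theory Defs
  imports Main
begin

record 'a qalg =
  carrier :: "'a set"
  mult :: "'a \<Rightarrow> 'a \<Rightarrow> 'a" (infixl "\<cdot>\<index>" 70)
  ldiv :: "'a \<Rightarrow> 'a \<Rightarrow> 'a" (infixl "\<setminus>\<index>" 70)
  rdiv :: "'a \<Rightarrow> 'a \<Rightarrow> 'a" (infixl "'/'/\<index>" 70)

text \<open>Operations are total functions on the ambient type, so an algebra is a carrier closed under
  them. The empty carrier is allowed.\<close>

definition qalgebra :: "'a qalg \<Rightarrow> bool" where
  "qalgebra A \<longleftrightarrow> (\<forall>x\<in>carrier A. \<forall>y\<in>carrier A.
     x \<cdot>\<^bsub>A\<^esub> y \<in> carrier A \<and> x \<setminus>\<^bsub>A\<^esub> y \<in> carrier A \<and> x //\<^bsub>A\<^esub> y \<in> carrier A)"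

definition quasigroup :: "'a qalg \<Rightarrow> bool" where
  "quasigroup Q \<longleftrightarrow> qalgebra Q \<and> (\<forall>x\<in>carrier Q. \<forall>y\<in>carrier Q.
     x \<setminus>\<^bsub>Q\<^esub> (x \<cdot>\<^bsub>Q\<^esub> y) = y \<and> x \<cdot>\<^bsub>Q\<^esub> (x \<setminus>\<^bsub>Q\<^esub> y) = y \<and>
     (x \<cdot>\<^bsub>Q\<^esub> y) //\<^bsub>Q\<^esub> y = x \<and> (x //\<^bsub>Q\<^esub> y) \<cdot>\<^bsub>Q\<^esub> y = x)"

definition left_loop :: "'a qalg \<Rightarrow> bool" where
  "left_loop Q \<longleftrightarrow> quasigroup Q \<and>
     (\<forall>x\<in>carrier Q. \<forall>y\<in>carrier Q. x //\<^bsub>Q\<^esub> x = y //\<^bsub>Q\<^esub> y)"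

definition right_zero_semigroup :: "'a qalg \<Rightarrow> bool" where
  "right_zero_semigroup R \<longleftrightarrow> qalgebra R \<and> (\<forall>x\<in>carrier R. \<forall>y\<in>carrier R.
     x \<cdot>\<^bsub>R\<^esub> y = y \<and> x \<setminus>\<^bsub>R\<^esub> y = y \<and> x //\<^bsub>R\<^esub> y = y)"

definition direct_product :: "'a qalg \<Rightarrow> 'b qalg \<Rightarrow> ('a \<times> 'b) qalg" where
  "direct_product A B =
     \<lparr>carrier = carrier A \<times> carrier B,
      mult = (\<lambda>p q. (fst p \<cdot>\<^bsub>A\<^esub> fst q, snd p \<cdot>\<^bsub>B\<^esub> snd q)),
      ldiv = (\<lambda>p q. (fst p \<setminus>\<^bsub>A\<^esub> fst q, snd p \<setminus>\<^bsub>B\<^esub> snd q)),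
      rdiv = (\<lambda>p q. (fst p //\<^bsub>A\<^esub> fst q, snd p //\<^bsub>B\<^esub> snd q))\<rparr>"

definition qalg_iso :: "('a \<Rightarrow> 'b) \<Rightarrow> 'a qalg \<Rightarrow> 'b qalg \<Rightarrow> bool" where
  "qalg_iso f A B \<longleftrightarrow> bij_betw f (carrier A) (carrier B) \<and>
     (\<forall>x\<in>carrier A. \<forall>y\<in>carrier A.
        f (x \<cdot>\<^bsub>A\<^esub> y) = f x \<cdot>\<^bsub>B\<^esub> f y \<and> f (x \<setminus>\<^bsub>A\<^esub> y) = f x \<setminus>\<^bsub>B\<^esub> f y \<and>
        f (x //\<^bsub>A\<^esub> y) = f x //\<^bsub>B\<^esub> f y)"

definition isomorphic :: "'a qalg \<Rightarrow> 'b qalg \<Rightarrow> bool" where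
  "isomorphic A B \<longleftrightarrow> qalgebra A \<and> qalgebra B \<and> (\<exists>f. qalg_iso f A B)"

text \<open>HOL cannot quantify existentially over types, so the two factors are sought among the algebras
  carried by subsets of the type of the given algebra. This loses nothing: the lemmas
  \<open>right_product_quasigroupI\<close> and \<open>right_product_left_loopI\<close> below admit
  factors over arbitrary types.\<close>

definition right_product_quasigroup :: "'a qalg \<Rightarrow> bool" where
  "right_product_quasigroup S \<longleftrightarrow> qalgebra S \<and>
     (\<exists>(Q :: 'a qalg) (R :: 'a qalg).
        quasigroup Q \<and> right_zero_semigroup R \<and> isomorphic S (direct_product Q R))"

definition right_product_left_loop :: "'a qalg \<Rightarrow> bool" where
  "right_product_left_loop S \<longleftrightarrow> qalgebra S \<and>
     (\<exists>(Q :: 'a qalg) (R :: 'a qalg).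
        left_loop Q \<and> right_zero_semigroup R \<and> isomorphic S (direct_product Q R))"

lemma transport:
  fixes A :: "'a qalg" and h :: "'a \<Rightarrow> 'b"
  assumes inj: "inj_on h (carrier A)" and A: "qalgebra A"
  obtains B :: "'b qalg" where "qalgebra B" "qalg_iso h A B"
    "quasigroup A \<Longrightarrow> quasigroup B" "left_loop A \<Longrightarrow> left_loop B"
    "right_zero_semigroup A \<Longrightarrow> right_zero_semigroup B"
proof -
  define k where "k = inv_into (carrier A) h"
  define B where "B = \<lparr>carrier = h ` carrier A,
      mult = (\<lambda>p q. h (k p \<cdot>\<^bsub>A\<^esub> k q)),
      ldiv = (\<lambda>p q. h (k p \<setminus>\<^bsub>A\<^esub> k q)),
      rdiv = (\<lambda>p q. h (k p //\<^bsub>A\<^esub> k q))\<rparr>"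
  have k: "k (h x) = x" if "x \<in> carrier A" for x
    using that inj by (simp add: k_def)
  have cl: "x \<cdot>\<^bsub>A\<^esub> y \<in> carrier A" "x \<setminus>\<^bsub>A\<^esub> y \<in> carrier A" "x //\<^bsub>A\<^esub> y \<in> carrier A"
    if "x \<in> carrier A" "y \<in> carrier A" for x y
    using A that by (auto simp: qalgebra_def)
  have 1: "qalgebra B" by (auto simp: B_def qalgebra_def k cl)
  have 2: "qalg_iso h A B"
    using inj by (auto simp: B_def qalg_iso_def bij_betw_def k)
  have 3: "quasigroup B" if "quasigroup A"
    using that 1 by (auto simp: B_def quasigroup_def k cl)
  have rdiv: "h x //\<^bsub>B\<^esub> h x = h (x //\<^bsub>A\<^esub> x)" if "x \<in> carrier A" for x
    using that by (simp add: B_def k)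
  have carr: "carrier B = h ` carrier A" by (simp add: B_def)
  have 4: "left_loop B" if "left_loop A"
    unfolding left_loop_def
  proof (intro conjI ballI)
    show "quasigroup B" using that 3 by (simp only: left_loop_def)
  next
    fix u v assume "u \<in> carrier B" "v \<in> carrier B"
    then obtain x y where "x \<in> carrier A" "y \<in> carrier A" "u = h x" "v = h y"
      unfolding carr by blast
    with that show "u //\<^bsub>B\<^esub> u = v //\<^bsub>B\<^esub> v"
      unfolding left_loop_def by (metis rdiv)
  qed
  have 5: "right_zero_semigroup B" if "right_zero_semigroup A"
    using that 1 by (auto simp: B_def right_zero_semigroup_def k)
  show thesis using that 1 2 3 4 5 by blast
qed

lemma isomorphic_direct_product_transport:
  fixes S :: "'a qalg" and Q :: "'b qalg" and R :: "'c qalg"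
  assumes "isomorphic S (direct_product Q R)" "qalgebra Q" "qalgebra R"
    and ne: "carrier S \<noteq> {}"
  obtains Q' :: "'a qalg" and R' :: "'a qalg" where
    "quasigroup Q \<Longrightarrow> quasigroup Q'" "left_loop Q \<Longrightarrow> left_loop Q'"
    "right_zero_semigroup R \<Longrightarrow> right_zero_semigroup R'"
    "isomorphic S (direct_product Q' R')"
proof -
  obtain f where f: "qalg_iso f S (direct_product Q R)" and S: "qalgebra S"
    using assms by (auto simp: isomorphic_def)
  have bij: "bij_betw f (carrier S) (carrier Q \<times> carrier R)"
    using f by (simp add: qalg_iso_def direct_product_def)
  obtain s where "s \<in> carrier S" using ne by blast
  then obtain q0 r0 where q0: "q0 \<in> carrier Q" and r0: "r0 \<in> carrier R"
    using bij by (metis SigmaE bij_betwE)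
  define g where "g = inv_into (carrier S) f"
  have g: "inj_on g (carrier Q \<times> carrier R)"
    using bij unfolding g_def by (simp add: bij_betw_imp_surj_on inj_on_inv_into)
  have "inj_on (\<lambda>q. g (q, r0)) (carrier Q)"
    using g r0 by (auto simp: inj_on_def)
  from transport[OF this \<open>qalgebra Q\<close>] obtain Q' :: "'a qalg" where
    Q': "qalgebra Q'" "qalg_iso (\<lambda>q. g (q, r0)) Q Q'"
    "quasigroup Q \<Longrightarrow> quasigroup Q'" "left_loop Q \<Longrightarrow> left_loop Q'" by metis
  have "inj_on (\<lambda>r. g (q0, r)) (carrier R)"
    using g q0 by (auto simp: inj_on_def)
  from transport[OF this \<open>qalgebra R\<close>] obtain R' :: "'a qalg" where
    R': "qalgebra R'" "qalg_iso (\<lambda>r. g (q0, r)) R R'"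
    "right_zero_semigroup R \<Longrightarrow> right_zero_semigroup R'" by metis
  let ?m = "map_prod (\<lambda>q. g (q, r0)) (\<lambda>r. g (q0, r))"
  have "bij_betw (?m \<circ> f) (carrier S) (carrier Q' \<times> carrier R')"
    using bij Q'(2) R'(2) unfolding qalg_iso_def
    by (intro bij_betw_trans[OF bij] bij_betw_map_prod) auto
  moreover have "f x \<in> carrier Q \<times> carrier R" if "x \<in> carrier S" for x
    using bij that by (auto simp: bij_betw_def)
  ultimately have "qalg_iso (?m \<circ> f) S (direct_product Q' R')"
    using f Q'(2) R'(2)
    by (auto simp: qalg_iso_def direct_product_def mem_Times_iff)
  moreover have "qalgebra (direct_product Q' R')"
    using Q'(1) R'(1) by (auto simp: qalgebra_def direct_product_def)
  ultimately have "isomorphic S (direct_product Q' R')"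
    using S unfolding isomorphic_def by blast
  then show thesis using that Q' R' by blast
qed

lemma empty_factors:
  assumes "carrier S = {}"
  shows "left_loop S" "right_zero_semigroup S" "isomorphic S (direct_product S S)"
  using assms
  by (auto simp: left_loop_def quasigroup_def right_zero_semigroup_def qalgebra_def
      isomorphic_def qalg_iso_def direct_product_def bij_betw_def)

lemma right_product_left_loopI:
  fixes S :: "'a qalg" and Q :: "'b qalg" and R :: "'c qalg"
  assumes "left_loop Q" "right_zero_semigroup R" "isomorphic S (direct_product Q R)"
  shows "right_product_left_loop S"
proof (cases "carrier S = {}")
  case True
  then show ?thesis
    using empty_factors[OF True]
    unfolding right_product_left_loop_def isomorphic_def by blast
next
  case False
  have "qalgebra Q" "qalgebra R"
    using assms unfolding left_loop_def quasigroup_def right_zero_semigroup_def by blast+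
  from isomorphic_direct_product_transport[OF assms(3) this False] assms show ?thesis
    unfolding right_product_left_loop_def isomorphic_def by metis
qed

lemma right_product_quasigroupI:
  fixes S :: "'a qalg" and Q :: "'b qalg" and R :: "'c qalg"
  assumes "quasigroup Q" "right_zero_semigroup R" "isomorphic S (direct_product Q R)"
  shows "right_product_quasigroup S"
proof (cases "carrier S = {}")
  case True
  then show ?thesis
    using empty_factors[OF True]
    unfolding right_product_quasigroup_def isomorphic_def left_loop_def by blast
next
  case False
  have "qalgebra Q" "qalgebra R"
    using assms unfolding quasigroup_def right_zero_semigroup_def by blast+
  from isomorphic_direct_product_transport[OF assms(3) this False] assms show ?thesis
    unfolding right_product_quasigroup_def isomorphic_def by metis
qed

definition LL1 :: "'a qalg \<Rightarrow> bool" where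
  "LL1 S \<longleftrightarrow> (\<forall>x\<in>carrier S. \<forall>y\<in>carrier S. (x //\<^bsub>S\<^esub> x) \<cdot>\<^bsub>S\<^esub> y = y)"

definition LL2 :: "'a qalg \<Rightarrow> bool" where
  "LL2 S \<longleftrightarrow> (\<forall>x\<in>carrier S. \<forall>y\<in>carrier S. \<forall>z\<in>carrier S.
     (x //\<^bsub>S\<^esub> x) \<cdot>\<^bsub>S\<^esub> z = (y //\<^bsub>S\<^esub> y) \<cdot>\<^bsub>S\<^esub> z)"

definition LL3 :: "('a \<Rightarrow> 'a \<Rightarrow> 'a) \<Rightarrow> 'a qalg \<Rightarrow> bool" where
  "LL3 c S \<longleftrightarrow> (\<forall>x\<in>carrier S. \<forall>y\<in>carrier S. c x y //\<^bsub>S\<^esub> c x y = y //\<^bsub>S\<^esub> y)"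

end

theory Submission
  imports Defs
begin

text \<open>All five identities are preserved by isomorphisms, and each of them holds in every right zero
  semigroup. Hence in a product of a quasigroup \<open>Q\<close> with a nonempty right zero semigroup
  an identity holds exactly if it holds in \<open>Q\<close>, and it remains to see that in a
  quasigroup each identity expresses that \<open>x / x\<close> does not depend on \<open>x\<close>.
  For the first two this is right cancellation. For the third it is the fact that
  \<open>x \<circ> y = a\<close> can be solved for \<open>x\<close>, whichever of the three operations
  \<open>\<circ>\<close> is, so that \<open>x \<circ> y\<close> is as arbitrary as an independent variable.

  The argument also shows that whether \<open>S \<cong> Q \<times> R\<close> is a right product left loop
  can be read off from \<open>Q\<close> in any such decomposition with \<open>R\<close> nonempty, even though
  being a right product left loop only asserts that some decomposition has a left loop as its first
  factor.\<close>

lemma quasigroup_closed: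
  assumes "quasigroup Q" "x \<in> carrier Q" "y \<in> carrier Q"
  shows "x \<cdot>\<^bsub>Q\<^esub> y \<in> carrier Q" "x \<setminus>\<^bsub>Q\<^esub> y \<in> carrier Q" "x //\<^bsub>Q\<^esub> y \<in> carrier Q"
  using assms by (auto simp: quasigroup_def qalgebra_def)

lemma quasigroup_right_cancel:
  assumes "quasigroup Q" "x \<in> carrier Q" "y \<in> carrier Q" "z \<in> carrier Q"
  shows "x \<cdot>\<^bsub>Q\<^esub> z = y \<cdot>\<^bsub>Q\<^esub> z \<longleftrightarrow> x = y"
proof
  assume "x \<cdot>\<^bsub>Q\<^esub> z = y \<cdot>\<^bsub>Q\<^esub> z"
  then have "(x \<cdot>\<^bsub>Q\<^esub> z) //\<^bsub>Q\<^esub> z = (y \<cdot>\<^bsub>Q\<^esub> z) //\<^bsub>Q\<^esub> z" by simp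
  then show "x = y" using assms by (simp add: quasigroup_def)
qed simp

lemma LL2_quasigroup_iff:
  assumes Q: "quasigroup Q"
  shows "LL2 Q \<longleftrightarrow> left_loop Q"
proof -
  have "(x //\<^bsub>Q\<^esub> x) \<cdot>\<^bsub>Q\<^esub> z = (y //\<^bsub>Q\<^esub> y) \<cdot>\<^bsub>Q\<^esub> z \<longleftrightarrow> x //\<^bsub>Q\<^esub> x = y //\<^bsub>Q\<^esub> y"
    if "x \<in> carrier Q" "y \<in> carrier Q" "z \<in> carrier Q" for x y z
    using Q that by (intro quasigroup_right_cancel quasigroup_closed)
  then show ?thesis unfolding LL2_def left_loop_def using Q by auto
qed

text \<open>Since \<open>(y / y) \<cdot> y = y\<close>, the first identity is the case \<open>z = y\<close> of
  the second.\<close>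

lemma LL1_quasigroup_iff:
  assumes Q: "quasigroup Q"
  shows "LL1 Q \<longleftrightarrow> left_loop Q"
proof -
  have "(x //\<^bsub>Q\<^esub> x) \<cdot>\<^bsub>Q\<^esub> y = y \<longleftrightarrow> x //\<^bsub>Q\<^esub> x = y //\<^bsub>Q\<^esub> y"
    if "x \<in> carrier Q" "y \<in> carrier Q" for x y
  proof -
    have "(y //\<^bsub>Q\<^esub> y) \<cdot>\<^bsub>Q\<^esub> y = y"
      using Q that by (simp add: quasigroup_def)
    then show ?thesis
      using quasigroup_right_cancel[OF Q, of "x //\<^bsub>Q\<^esub> x" "y //\<^bsub>Q\<^esub> y" y]
        quasigroup_closed[OF Q] that by simp
  qed
  then show ?thesis unfolding LL1_def left_loop_def using Q by auto
qed

lemma LL3_quasigroup_iff: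
  assumes Q: "quasigroup Q"
    and closed: "\<And>x y. x \<in> carrier Q \<Longrightarrow> y \<in> carrier Q \<Longrightarrow> c x y \<in> carrier Q"
    and solvable: "\<And>a y. a \<in> carrier Q \<Longrightarrow> y \<in> carrier Q \<Longrightarrow> \<exists>x\<in>carrier Q. c x y = a"
  shows "LL3 c Q \<longleftrightarrow> left_loop Q"
  using assms unfolding LL3_def left_loop_def by metis

lemma quasigroup_left_solvable:
  assumes Q: "quasigroup Q" and "a \<in> carrier Q" "y \<in> carrier Q"
  shows "\<exists>x\<in>carrier Q. x \<cdot>\<^bsub>Q\<^esub> y = a"
    and "\<exists>x\<in>carrier Q. x \<setminus>\<^bsub>Q\<^esub> y = a"
    and "\<exists>x\<in>carrier Q. x //\<^bsub>Q\<^esub> y = a"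
proof -
  show "\<exists>x\<in>carrier Q. x \<cdot>\<^bsub>Q\<^esub> y = a"
    using assms unfolding quasigroup_def qalgebra_def
    by (intro bexI[of _ "a //\<^bsub>Q\<^esub> y"]) auto
  have "(y //\<^bsub>Q\<^esub> a) \<setminus>\<^bsub>Q\<^esub> ((y //\<^bsub>Q\<^esub> a) \<cdot>\<^bsub>Q\<^esub> a) = a" "(y //\<^bsub>Q\<^esub> a) \<cdot>\<^bsub>Q\<^esub> a = y"
    using assms quasigroup_closed(3)[OF Q] unfolding quasigroup_def by blast+
  then show "\<exists>x\<in>carrier Q. x \<setminus>\<^bsub>Q\<^esub> y = a"
    using assms quasigroup_closed[OF Q] by (intro bexI[of _ "y //\<^bsub>Q\<^esub> a"]) auto
  show "\<exists>x\<in>carrier Q. x //\<^bsub>Q\<^esub> y = a"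
    using assms unfolding quasigroup_def qalgebra_def
    by (intro bexI[of _ "a \<cdot>\<^bsub>Q\<^esub> y"]) auto
qed

text \<open>An algebra isomorphic to \<open>Q \<times> R\<close> is handled through its two coordinate maps
  \<open>g\<close> and \<open>h\<close>, which turns the isomorphism and the product into a single
  step. Of \<open>R\<close> nothing is left but the rule that \<open>h\<close> sees only the right operand of
  each operation. Hence an equation between terms with the same rightmost variable holds in
  \<open>S\<close> exactly if its image under \<open>g\<close> holds in \<open>Q\<close>.\<close>

locale right_product_coordinates =
  fixes S :: "'a qalg" and Q :: "'b qalg" and g :: "'a \<Rightarrow> 'b" and h :: "'a \<Rightarrow> 'c"
  assumes S: "qalgebra S" and Q: "quasigroup Q"
    and image: "g ` carrier S = carrier Q"
    and inj: "\<And>x y. x \<in> carrier S \<Longrightarrow> y \<in> carrier S \<Longrightarrow> g x = g y \<Longrightarrow> h x = h y \<Longrightarrow> x = y"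
    and g_hom: "\<And>x y. x \<in> carrier S \<Longrightarrow> y \<in> carrier S \<Longrightarrow> g (x \<cdot>\<^bsub>S\<^esub> y) = g x \<cdot>\<^bsub>Q\<^esub> g y"
      "\<And>x y. x \<in> carrier S \<Longrightarrow> y \<in> carrier S \<Longrightarrow> g (x \<setminus>\<^bsub>S\<^esub> y) = g x \<setminus>\<^bsub>Q\<^esub> g y"
      "\<And>x y. x \<in> carrier S \<Longrightarrow> y \<in> carrier S \<Longrightarrow> g (x //\<^bsub>S\<^esub> y) = g x //\<^bsub>Q\<^esub> g y"
    and h_right: "\<And>x y. x \<in> carrier S \<Longrightarrow> y \<in> carrier S \<Longrightarrow> h (x \<cdot>\<^bsub>S\<^esub> y) = h y"
      "\<And>x y. x \<in> carrier S \<Longrightarrow> y \<in> carrier S \<Longrightarrow> h (x \<setminus>\<^bsub>S\<^esub> y) = h y"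
      "\<And>x y. x \<in> carrier S \<Longrightarrow> y \<in> carrier S \<Longrightarrow> h (x //\<^bsub>S\<^esub> y) = h y"
begin

lemma closed [simp]:
  assumes "x \<in> carrier S" "y \<in> carrier S"
  shows "x \<cdot>\<^bsub>S\<^esub> y \<in> carrier S" "x \<setminus>\<^bsub>S\<^esub> y \<in> carrier S" "x //\<^bsub>S\<^esub> y \<in> carrier S"
  using S assms by (auto simp: qalgebra_def)

lemma eq_iff_g_eq:
  assumes "x \<in> carrier S" "y \<in> carrier S" "h x = h y"
  shows "x = y \<longleftrightarrow> g x = g y"
  using assms inj by blast

lemma LL1_iff: "LL1 S \<longleftrightarrow> left_loop Q"
proof -
  have "LL1 S \<longleftrightarrow> LL1 Q"
    unfolding LL1_def image[symmetric] by (auto simp: eq_iff_g_eq h_right g_hom)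
  then show ?thesis using LL1_quasigroup_iff[OF Q] by simp
qed

lemma LL2_iff: "LL2 S \<longleftrightarrow> left_loop Q"
proof -
  have "LL2 S \<longleftrightarrow> LL2 Q"
    unfolding LL2_def image[symmetric] by (auto simp: eq_iff_g_eq h_right g_hom)
  then show ?thesis using LL2_quasigroup_iff[OF Q] by simp
qed

lemma LL3_iff:
  "LL3 (mult S) S \<longleftrightarrow> left_loop Q"
  "LL3 (ldiv S) S \<longleftrightarrow> left_loop Q"
  "LL3 (rdiv S) S \<longleftrightarrow> left_loop Q"
proof -
  have "LL3 (mult S) S \<longleftrightarrow> LL3 (mult Q) Q"
    unfolding LL3_def image[symmetric] by (auto simp: eq_iff_g_eq h_right g_hom)
  also have "\<dots> \<longleftrightarrow> left_loop Q"
    by (intro LL3_quasigroup_iff Q quasigroup_closed quasigroup_left_solvable)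
  finally show "LL3 (mult S) S \<longleftrightarrow> left_loop Q" .
  have "LL3 (ldiv S) S \<longleftrightarrow> LL3 (ldiv Q) Q"
    unfolding LL3_def image[symmetric] by (auto simp: eq_iff_g_eq h_right g_hom)
  also have "\<dots> \<longleftrightarrow> left_loop Q"
    by (intro LL3_quasigroup_iff Q quasigroup_closed quasigroup_left_solvable)
  finally show "LL3 (ldiv S) S \<longleftrightarrow> left_loop Q" .
  have "LL3 (rdiv S) S \<longleftrightarrow> LL3 (rdiv Q) Q"
    unfolding LL3_def image[symmetric] by (auto simp: eq_iff_g_eq h_right g_hom)
  also have "\<dots> \<longleftrightarrow> left_loop Q"
    by (intro LL3_quasigroup_iff Q quasigroup_closed quasigroup_left_solvable)
  finally show "LL3 (rdiv S) S \<longleftrightarrow> left_loop Q" .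
qed

end

text \<open>The carrier has to be nonempty, for if \<open>R\<close> is empty, so is \<open>Q \<times> R\<close>, and then
  the first coordinate map need not be onto \<open>Q\<close>.\<close>

lemma right_product_coordinatesI:
  assumes Q: "quasigroup Q" and R: "right_zero_semigroup R"
    and S: "qalgebra S" and ne: "carrier S \<noteq> {}" and f: "qalg_iso f S (direct_product Q R)"
  shows "right_product_coordinates S Q (fst \<circ> f) (snd \<circ> f)"
proof -
  have f_image: "f ` carrier S = carrier Q \<times> carrier R" and f_inj: "inj_on f (carrier S)"
    using f by (auto simp: qalg_iso_def direct_product_def bij_betw_def)
  then have "carrier R \<noteq> {}" using ne by auto
  then have image: "(fst \<circ> f) ` carrier S = carrier Q"
    unfolding image_comp[symmetric] f_image by simp
  have coords: "fst (f x) \<in> carrier Q" "snd (f x) \<in> carrier R" if "x \<in> carrier S" for x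
  proof -
    have "f x \<in> carrier Q \<times> carrier R" using that f_image by blast
    then show "fst (f x) \<in> carrier Q" "snd (f x) \<in> carrier R" by (auto simp: mem_Times_iff)
  qed
  show ?thesis
    using S Q image f R coords f_inj
    by unfold_locales
      (auto simp: qalg_iso_def direct_product_def right_zero_semigroup_def prod_eq_iff inj_on_def)
qed

text \<open>One direction applies the criterion \<open>factor\<close> to a decomposition with a left loop
  factor, the other to the given decomposition. This is why the criterion is required for all
  coordinates of \<open>S\<close>. An empty \<open>S\<close> has no useful coordinates but is a right
  product left loop, so there \<open>P\<close> has to hold outright.\<close>

lemma right_product_left_loop_iffI:
  fixes S :: "'a qalg"
  assumes S: "right_product_quasigroup S"
    and empty: "carrier S = {} \<Longrightarrow> P"
    and factor: "\<And>(Q :: 'a qalg) g (h :: 'a \<Rightarrow> 'a). right_product_coordinates S Q g h \<Longrightarrow>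
      P \<longleftrightarrow> left_loop Q"
  shows "right_product_left_loop S \<longleftrightarrow> P"
proof (cases "carrier S = {}")
  case True
  then show ?thesis
    using empty right_product_left_loopI empty_factors by blast
next
  case False
  have decomposition: "P \<longleftrightarrow> left_loop Q"
    if "quasigroup Q" "right_zero_semigroup R" "isomorphic S (direct_product Q R)"
    for Q R :: "'a qalg"
    using that False right_product_coordinatesI factor unfolding isomorphic_def by metis
  show ?thesis
  proof
    assume "right_product_left_loop S"
    then show P
      using decomposition unfolding right_product_left_loop_def left_loop_def by metis
  next
    assume P
    then show "right_product_left_loop S"
      using S decomposition
      unfolding right_product_quasigroup_def right_product_left_loop_def by metis
  qed
qed

theorem corollary2p17:
  fixes S :: "'a qalg"
  assumes "right_product_quasigroup S"
  shows "(right_product_left_loop S \<longleftrightarrow> LL1 S) \<and>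
    (right_product_left_loop S \<longleftrightarrow> LL2 S) \<and>
    (right_product_left_loop S \<longleftrightarrow> LL3 (mult S) S) \<and>
    (right_product_left_loop S \<longleftrightarrow> LL3 (ldiv S) S) \<and>
    (right_product_left_loop S \<longleftrightarrow> LL3 (rdiv S) S)"
proof (intro conjI)
  show "right_product_left_loop S \<longleftrightarrow> LL1 S"
    by (rule right_product_left_loop_iffI[OF assms])
      (simp add: LL1_def, rule right_product_coordinates.LL1_iff)
  show "right_product_left_loop S \<longleftrightarrow> LL2 S"
    by (rule right_product_left_loop_iffI[OF assms])
      (simp add: LL2_def, rule right_product_coordinates.LL2_iff)
  show "right_product_left_loop S \<longleftrightarrow> LL3 (mult S) S"
    by (rule right_product_left_loop_iffI[OF assms])
      (simp add: LL3_def, rule right_product_coordinates.LL3_iff(1))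
  show "right_product_left_loop S \<longleftrightarrow> LL3 (ldiv S) S"
    by (rule right_product_left_loop_iffI[OF assms])
      (simp add: LL3_def, rule right_product_coordinates.LL3_iff(2))
  show "right_product_left_loop S \<longleftrightarrow> LL3 (rdiv S) S"
    by (rule right_product_left_loop_iffI[OF assms])
      (simp add: LL3_def, rule right_product_coordinates.LL3_iff(3))
qed

end
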